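(* Let $(D,G_o)$ be a two-sender unicast index-coding problem with a fully participated interaction between its sub-digraphs $D_1,D_2,D_3$. Suppose that $f(D)$ contains both arcs $(1,2)$ and $(2,1)$, contains neither $(1,3)$ nor $(2,3)$, and contains at least one of $(3,1)$, $(3,2)$. If $$\min\{\beta(D_1),\beta(D_2)\}\le\beta(D_3)\le\max\{\beta(D_1),\beta(D_2)\},$$ then $$\beta(D,G_o)=\beta(D)=\beta(D_3)+\max\{\beta(D_1),\beta(D_2)\}.$$
   Context: There are $N$ messages $\mathcal{M}=\{x_1,\dots,x_N\}$, $x_i\in\{0,1\}^t$, and $N$ receivers; receiver $r$ requests $x_r$ and knows $\{x_j: j\in N_D^+(r)\}$, where $D$ is a loopless digraph on $V(D)=\{1,\dots,N\}$ (the side-information digraph) and $N_D^+(r)$ is the out-neighborhood of $r$. Single sender: an index code is an encoding function of all messages into $\{0,1\}^p$ together with decoding functions by which every receiver $r$ recovers $x_r$, for all message realizations, from the codeword and its side information. $\beta_t(D)$ is the minimum of $p/t$ over index codes for $t$-bit messages, and $\beta(D)=\inf_t\beta_t(D)=\lim_{t\to\infty}\beta_t(D)$. Two senders: senders $S_1,S_2$ know $\mathcal{M}_1,\mathcal{M}_2$ with $\mathcal{M}_1\cup\mathcal{M}_2=\mathcal{M}$. A two-sender index code consists of encoding functions $\mathscr{F}_s:\{0,1\}^{|\mathcal{M}_s|t}\to\{0,1\}^{p_s}$, $s=1,2$ ($p_s\ge0$ an integer), and decoding functions by which every receiver $r$ recovers $x_r$, for all message realizations, from both sub-codewords and its side information.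 $\beta_t(D,G_o)$ is the minimum of $(p_1+p_2)/t$ over two-sender index codes for $t$-bit messages, and $\beta(D,G_o)=\inf_t\beta_t(D,G_o)=\lim_{t\to\infty}\beta_t(D,G_o)$. Here $G_o$ (the sender-constraint graph, with vertex set $V(D)$ and an edge $ij$ iff one of $x_i,x_j$ is in $\mathcal{M}_1\setminus\mathcal{M}_2$ and the other in $\mathcal{M}_2\setminus\mathcal{M}_1$) records the senders' message sets. Let $\mathcal{P}_1=\mathcal{M}_1\setminus\mathcal{M}_2$, $\mathcal{P}_2=\mathcal{M}_2\setminus\mathcal{M}_1$, $\mathcal{P}_3=\mathcal{M}_1\cap\mathcal{M}_2$. For $i\in\{1,2,3\}$, $D_i$ is the sub-digraph of $D$ induced by $\{j:x_j\in\mathcal{P}_i\}$. The digraph $f(D)$ has vertex set $\{1,2,3\}$, and $(i,j)$, $i\neq j$, is an arc of $f(D)$ iff there is an arc of $D$ from some vertex of $D_i$ to some vertex of $D_j$. The interaction is fully participated if, whenever $(i,j)$ is an arc of $f(D)$, every vertex of $D_i$ has arcs to all vertices of $D_j$. *)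

theory Defs
  imports Complex_Main "HOL-Library.FuncSet" "Graph_Theory.Digraph_Component"
begin

definition bits :: "nat \<Rightarrow> bool list set" where
  "bits n = {w. length w = n}"

(* Messages are identified with their indices: a realization of the t-bit messages with indices
   in I is an extensional function on I, so {0,1}^(|I| t) appears as a dependent product. *)
definition realizations :: "'a set \<Rightarrow> nat \<Rightarrow> ('a \<Rightarrow> bool list) set" where
  "realizations I t = (\<Pi>\<^sub>E i\<in>I. bits t)"

definition out_neighborhood :: "('a, 'b) pre_digraph \<Rightarrow> 'a \<Rightarrow> 'a set" where
  "out_neighborhood D r = {j. r \<rightarrow>\<^bsub>D\<^esub> j}"

definition index_code ::
  "('a, 'b) pre_digraph \<Rightarrow> nat \<Rightarrow> nat \<Rightarrow>
   (('a \<Rightarrow> bool list) \<Rightarrow> bool list) \<Rightarrow>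
   ('a \<Rightarrow> bool list \<Rightarrow> ('a \<Rightarrow> bool list) \<Rightarrow> bool list) \<Rightarrow> bool" where
  "index_code D t p F G \<longleftrightarrow>
     F \<in> realizations (verts D) t \<rightarrow> bits p \<and>
     (\<forall>x \<in> realizations (verts D) t. \<forall>r \<in> verts D.
        G r (F x) (restrict x (out_neighborhood D r)) = x r)"

definition beta_t :: "('a, 'b) pre_digraph \<Rightarrow> nat \<Rightarrow> real" where
  "beta_t D t = real (LEAST p. \<exists>F G. index_code D t p F G) / real t"

(* Only t \<ge> 1 is allowed: for t = 0 the quotient would be 0 by convention. *)
definition beta :: "('a, 'b) pre_digraph \<Rightarrow> real" where
  "beta D = (INF t\<in>{1..}. beta_t D t)"

(* M1, M2 are the index sets of the messages known to the two senders. *)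
definition two_sender_index_code ::
  "('a, 'b) pre_digraph \<Rightarrow> 'a set \<Rightarrow> 'a set \<Rightarrow> nat \<Rightarrow> nat \<Rightarrow> nat \<Rightarrow>
   (('a \<Rightarrow> bool list) \<Rightarrow> bool list) \<Rightarrow> (('a \<Rightarrow> bool list) \<Rightarrow> bool list) \<Rightarrow>
   ('a \<Rightarrow> bool list \<Rightarrow> bool list \<Rightarrow> ('a \<Rightarrow> bool list) \<Rightarrow> bool list) \<Rightarrow> bool" where
  "two_sender_index_code D M1 M2 t p1 p2 F1 F2 G \<longleftrightarrow>
     F1 \<in> realizations M1 t \<rightarrow> bits p1 \<and>
     F2 \<in> realizations M2 t \<rightarrow> bits p2 \<and>
     (\<forall>x \<in> realizations (verts D) t. \<forall>r \<in> verts D.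
        G r (F1 (restrict x M1)) (F2 (restrict x M2)) (restrict x (out_neighborhood D r)) = x r)"

definition two_sender_beta_t ::
  "('a, 'b) pre_digraph \<Rightarrow> 'a set \<Rightarrow> 'a set \<Rightarrow> nat \<Rightarrow> real" where
  "two_sender_beta_t D M1 M2 t =
     real (LEAST p. \<exists>p1 p2 F1 F2 G. p = p1 + p2 \<and>
       two_sender_index_code D M1 M2 t p1 p2 F1 F2 G) / real t"

(* This is \<beta>(D, G_o), where the sender-constraint graph G_o is the complete bipartite graph
   between M1 - M2 and M2 - M1; the senders' message sets, which G_o records, are passed directly. *)
definition two_sender_beta :: "('a, 'b) pre_digraph \<Rightarrow> 'a set \<Rightarrow> 'a set \<Rightarrow> real" where
  "two_sender_beta D M1 M2 = (INF t\<in>{1..}. two_sender_beta_t D M1 M2 t)"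

definition message_part :: "'a set \<Rightarrow> 'a set \<Rightarrow> nat \<Rightarrow> 'a set" where
  "message_part M1 M2 i =
     (if i = 1 then M1 - M2 else if i = 2 then M2 - M1 else if i = 3 then M1 \<inter> M2 else {})"

definition sub_digraph ::
  "('a, 'b) pre_digraph \<Rightarrow> 'a set \<Rightarrow> 'a set \<Rightarrow> nat \<Rightarrow> ('a, 'b) pre_digraph" where
  "sub_digraph D M1 M2 i = D \<restriction> message_part M1 M2 i"

(* The digraph f(D). *)
definition interaction_digraph ::
  "('a, 'b) pre_digraph \<Rightarrow> 'a set \<Rightarrow> 'a set \<Rightarrow> (nat, nat \<times> nat) pre_digraph" where
  "interaction_digraph D M1 M2 =
     \<lparr> verts = {1, 2, 3},
       arcs = {(i, j). i \<in> {1, 2, 3} \<and> j \<in> {1, 2, 3} \<and> i \<noteq> j \<and>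
         (\<exists>u \<in> verts (sub_digraph D M1 M2 i). \<exists>v \<in> verts (sub_digraph D M1 M2 j). u \<rightarrow>\<^bsub>D\<^esub> v)},
       tail = fst, head = snd \<rparr>"

definition fully_participated :: "('a, 'b) pre_digraph \<Rightarrow> 'a set \<Rightarrow> 'a set \<Rightarrow> bool" where
  "fully_participated D M1 M2 \<longleftrightarrow>
     (\<forall>i j. (i, j) \<in> arcs (interaction_digraph D M1 M2) \<longrightarrow>
       (\<forall>u \<in> verts (sub_digraph D M1 M2 i). \<forall>v \<in> verts (sub_digraph D M1 M2 j). u \<rightarrow>\<^bsub>D\<^esub> v))"

end

theory Submission
  imports Defs "HOL-Real_Asymp.Real_Asymp"
begin

text \<open>A code is a coloring of the confusion graph, whose independent sets are compared with its
  chromatic number up to a factor polynomial in \<open>t\<close>; hence \<open>\<beta>\<close> is the limit of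
  \<open>log (|R| / \<alpha>) / t\<close>, with \<open>R\<close> the realizations and \<open>\<alpha>\<close> the independence number.
  If no arc leads from \<open>A\<close> to \<open>B\<close>, independent sets over \<open>A \<union> B\<close> are bounded as in a
  lexicographic product, where \<open>\<alpha>\<close> is multiplicative, so \<open>\<beta>\<close> is superadditive.
  Applied to parts 1, 3 and to parts 2, 3 this gives the lower bound; the upper bound
  is reached by two senders XOR-ing the codeword of part 3 onto those of parts 1 and 2.\<close>

section \<open>Codes as colorings of the confusion graph\<close>

text \<open>Adjacency in the confusion graph: receiver \<open>r\<close> has the same side
  information under \<open>x\<close> and \<open>y\<close> but must output different messages, so
  only the codeword can tell the two apart.\<close>

definition confusable :: "('a, 'b) pre_digraph \<Rightarrow> ('a \<Rightarrow> bool list) \<Rightarrow> ('a \<Rightarrow> bool list) \<Rightarrow> bool" where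
  "confusable D x y \<longleftrightarrow> (\<exists>r\<in>verts D. x r \<noteq> y r \<and> (\<forall>j\<in>out_neighborhood D r. x j = y j))"

text \<open>A proper coloring of the confusion graph. The type of colors is left open because
  codewords, pairs of sub-codewords and translation vectors all serve as colors below.\<close>

definition separating ::
  "('a, 'b) pre_digraph \<Rightarrow> nat \<Rightarrow> (('a \<Rightarrow> bool list) \<Rightarrow> 'c) \<Rightarrow> bool" where
  "separating D t F \<longleftrightarrow>
     (\<forall>x\<in>realizations (verts D) t. \<forall>y\<in>realizations (verts D) t. confusable D x y \<longrightarrow> F x \<noteq> F y)"

lemma separatingD:
  assumes "separating D t F" "x \<in> realizations (verts D) t" "y \<in> realizations (verts D) t"
    and "F x = F y"
  shows "\<not> confusable D x y"
  using assms unfolding separating_def by blast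

lemma restrict_eq_iff: "restrict x A = restrict y A \<longleftrightarrow> (\<forall>j\<in>A. x j = y j)"
  by (metis restrict_apply' restrict_ext)

text \<open>The decoder outputs message \<open>r\<close> of any realization compatible with the
  codeword and the side information; two compatible ones that differ at \<open>r\<close> would be
  confusable with equal colors.\<close>

lemma separating_imp_decoder:
  assumes "separating D t F"
  shows "\<exists>G. \<forall>x\<in>realizations (verts D) t. \<forall>r\<in>verts D.
           G r (F x) (restrict x (out_neighborhood D r)) = x r"
proof -
  define G where "G r c s = (SOME v. \<exists>x\<in>realizations (verts D) t.
      F x = c \<and> restrict x (out_neighborhood D r) = s \<and> v = x r)" for r c s
  have "G r (F x) (restrict x (out_neighborhood D r)) = x r"
    if x: "x \<in> realizations (verts D) t" and r: "r \<in> verts D" for x r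
  proof -
    have "\<exists>y\<in>realizations (verts D) t. F y = F x \<and>
      restrict y (out_neighborhood D r) = restrict x (out_neighborhood D r) \<and>
      G r (F x) (restrict x (out_neighborhood D r)) = y r"
      unfolding G_def by (rule someI_ex) (use x in blast)
    then obtain y where y: "y \<in> realizations (verts D) t" "F y = F x"
      "\<forall>j\<in>out_neighborhood D r. y j = x j"
      "G r (F x) (restrict x (out_neighborhood D r)) = y r"
      unfolding restrict_eq_iff by blast
    have "\<not> confusable D y x"
      using separatingD[OF assms y(1) x y(2)] .
    then show ?thesis
      using y(3,4) r unfolding confusable_def by auto
  qed
  then show ?thesis by blast
qed

lemma ex_index_code_iff:
  "(\<exists>G. index_code D t p F G) \<longleftrightarrow>
   F \<in> realizations (verts D) t \<rightarrow> bits p \<and> separating D t F"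
proof
  assume "\<exists>G. index_code D t p F G"
  then obtain G where G: "F \<in> realizations (verts D) t \<rightarrow> bits p"
    "\<And>x r. x \<in> realizations (verts D) t \<Longrightarrow> r \<in> verts D \<Longrightarrow>
        G r (F x) (restrict x (out_neighborhood D r)) = x r"
    unfolding index_code_def by blast
  have "separating D t F"
    unfolding separating_def confusable_def
    using G(2) by (metis restrict_eq_iff)
  with G(1) show "F \<in> realizations (verts D) t \<rightarrow> bits p \<and> separating D t F" by blast
next
  assume "F \<in> realizations (verts D) t \<rightarrow> bits p \<and> separating D t F"
  then show "\<exists>G. index_code D t p F G"
    using separating_imp_decoder[of D t F] unfolding index_code_def by blast
qed

section \<open>Counting and restricting realizations\<close>

lemma finite_bits: "finite (bits n)" and card_bits: "card (bits n) = 2 ^ n"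
proof -
  have "bits n = {xs. set xs \<subseteq> UNIV \<and> length xs = n}"
    by (simp add: bits_def)
  then show "finite (bits n)" "card (bits n) = 2 ^ n"
    using finite_lists_length_eq[of "UNIV :: bool set" n] card_lists_length_eq[of "UNIV :: bool set" n]
    by simp_all
qed

lemma realizations_nonempty: "realizations V t \<noteq> {}"
  unfolding realizations_def using finite_bits card_bits[of t]
  by (auto simp: PiE_eq_empty_iff)

lemma finite_realizations: "finite V \<Longrightarrow> finite (realizations V t)"
  unfolding realizations_def by (simp add: finite_PiE finite_bits)

lemma card_realizations: "finite V \<Longrightarrow> card (realizations V t) = 2 ^ (card V * t)"
  unfolding realizations_def by (simp add: card_PiE card_bits power_mult[symmetric] mult.commute)

lemma restrict_realizations:
  "x \<in> realizations V t \<Longrightarrow> A \<subseteq> V \<Longrightarrow> restrict x A \<in> realizations A t"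
  unfolding realizations_def by auto

lemma length_realizations: "x \<in> realizations V t \<Longrightarrow> i \<in> V \<Longrightarrow> length (x i) = t"
  unfolding realizations_def bits_def by auto

lemma realizations_outside: "x \<in> realizations V t \<Longrightarrow> i \<notin> V \<Longrightarrow> x i = undefined"
  unfolding realizations_def by auto

section \<open>Optimal code length, its subadditivity and the rate\<close>

definition optimal_length :: "('a, 'b) pre_digraph \<Rightarrow> nat \<Rightarrow> nat" where
  "optimal_length D t = (LEAST p. \<exists>F G. index_code D t p F G)"

lemma optimal_length_le:
  "F \<in> realizations (verts D) t \<rightarrow> bits p \<Longrightarrow> separating D t F \<Longrightarrow> optimal_length D t \<le> p"
  unfolding optimal_length_def using ex_index_code_iff by (metis (mono_tags, lifting) Least_le)

text \<open>Colors matter only up to injective renaming, so a palette of at most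
  \<open>2 ^ p\<close> colors embeds into the words of length \<open>p\<close>.\<close>

lemma coloring_imp_code:
  assumes "finite C" "card C \<le> 2 ^ p"
    and "c \<in> realizations (verts D) t \<rightarrow> C" "separating D t c"
  shows "\<exists>F. F \<in> realizations (verts D) t \<rightarrow> bits p \<and> separating D t F"
proof -
  obtain \<phi> where \<phi>: "\<phi> ` C \<subseteq> bits p" "inj_on \<phi> C"
    using card_le_inj[OF assms(1) finite_bits, of p] assms(2) by (auto simp: card_bits)
  have "\<phi> \<circ> c \<in> realizations (verts D) t \<rightarrow> bits p"
    using \<phi>(1) assms(3) by (auto simp: Pi_iff image_subset_iff)
  moreover have "separating D t (\<phi> \<circ> c)"
    using assms(3,4) inj_onD[OF \<phi>(2)] unfolding separating_def by (fastforce simp: Pi_iff)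
  ultimately show ?thesis by blast
qed

lemma separating_id: "separating D t (\<lambda>x. x)"
  unfolding separating_def confusable_def by auto

lemma optimal_code:
  assumes "finite (verts D)"
  obtains F where "F \<in> realizations (verts D) t \<rightarrow> bits (optimal_length D t)" "separating D t F"
proof -
  \<comment> \<open>Uncoded transmission: it shows that the minimum in \<open>optimal_length\<close>
    ranges over a nonempty set and is attained.\<close>
  have "\<exists>F. F \<in> realizations (verts D) t \<rightarrow> bits (card (verts D) * t) \<and> separating D t F"
    by (rule coloring_imp_code[OF finite_realizations[OF assms, of t], of _ "\<lambda>x. x"])
      (auto simp: card_realizations[OF assms] separating_id)
  then have "\<exists>p F G. index_code D t p F G"
    using ex_index_code_iff by blast
  then have "\<exists>F G. index_code D t (optimal_length D t) F G"
    unfolding optimal_length_def by (rule LeastI_ex)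
  then show thesis
    using that ex_index_code_iff by blast
qed

text \<open>Cut every message into its first \<open>s\<close> and its last \<open>t\<close> bits,
  encode the two blocks separately and concatenate. If a requested message differs, so does one of
  its blocks, while the side information agrees in both.\<close>

lemma optimal_length_add_le:
  assumes "finite (verts D)"
  shows "optimal_length D (s + t) \<le> optimal_length D s + optimal_length D t"
proof -
  let ?R = "realizations (verts D)"
  obtain F where F: "F \<in> ?R s \<rightarrow> bits (optimal_length D s)" "separating D s F"
    using optimal_code[OF assms] .
  obtain F' where F': "F' \<in> ?R t \<rightarrow> bits (optimal_length D t)" "separating D t F'"
    using optimal_code[OF assms] .
  define a where "a x = (\<lambda>i\<in>verts D. take s (x i))" for x :: "'a \<Rightarrow> bool list"
  define b where "b x = (\<lambda>i\<in>verts D. drop s (x i))" for x :: "'a \<Rightarrow> bool list"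
  have a: "a x \<in> ?R s" and b: "b x \<in> ?R t" if "x \<in> ?R (s + t)" for x
    using length_realizations[OF that] unfolding a_def b_def realizations_def bits_def by auto
  show ?thesis
  proof (rule optimal_length_le)
    show "(\<lambda>x. F (a x) @ F' (b x)) \<in> ?R (s + t) \<rightarrow> bits (optimal_length D s + optimal_length D t)"
      using F(1) F'(1) a b by (auto simp: bits_def Pi_iff)
    show "separating D (s + t) (\<lambda>x. F (a x) @ F' (b x))"
      unfolding separating_def
    proof (intro ballI impI notI)
      fix x y assume xy: "x \<in> ?R (s + t)" "y \<in> ?R (s + t)" and "confusable D x y"
        and eq: "F (a x) @ F' (b x) = F (a y) @ F' (b y)"
      then obtain r where r: "r \<in> verts D" "x r \<noteq> y r" "\<forall>j\<in>out_neighborhood D r. x j = y j"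
        unfolding confusable_def by blast
      have "length (F (a x)) = length (F (a y))"
        using F(1) a[OF xy(1)] a[OF xy(2)] by (auto simp: bits_def Pi_iff)
      then have "F (a x) = F (a y)" "F' (b x) = F' (b y)"
        using eq by auto
      then have "\<not> confusable D (a x) (a y)" "\<not> confusable D (b x) (b y)"
        using separatingD[OF F(2)] separatingD[OF F'(2)] a b xy by blast+
      moreover have "a x j = a y j" "b x j = b y j" if "j \<in> out_neighborhood D r" for j
        using r(3) that by (auto simp: a_def b_def restrict_def)
      ultimately have "a x r = a y r" "b x r = b y r"
        using r(1) unfolding confusable_def by blast+
      then show False
        using r(1,2) unfolding a_def b_def by (metis append_take_drop_id restrict_apply')
    qed
  qed
qed

lemma optimal_length_mult_le:
  assumes "finite (verts D)"
  shows "optimal_length D (Suc k * t) \<le> Suc k * optimal_length D t"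
proof (induction k)
  case (Suc k)
  then show ?case
    using optimal_length_add_le[OF assms, of t "Suc k * t"] by simp
qed simp

lemma beta_t_eq: "beta_t D t = real (optimal_length D t) / real t"
  unfolding beta_t_def optimal_length_def ..

text \<open>Coding \<open>k\<close> blocks separately keeps the rate. This allows passing to common
  or arbitrarily large multiples of a message length.\<close>

lemma beta_t_mult_le:
  assumes "finite (verts D)" "k \<ge> 1"
  shows "beta_t D (k * t) \<le> beta_t D t"
proof -
  obtain k' where k: "k = Suc k'"
    using assms(2) by (cases k) auto
  have "real (optimal_length D (k * t)) \<le> real k * real (optimal_length D t)"
    using optimal_length_mult_le[OF assms(1), of k' t] unfolding k
    by (metis of_nat_le_iff of_nat_mult)
  then have "real (optimal_length D (k * t)) / (real k * real t)
      \<le> (real k * real (optimal_length D t)) / (real k * real t)"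
    by (rule divide_right_mono) simp
  also have "\<dots> = real (optimal_length D t) / real t"
    using assms(2) by simp
  finally show ?thesis
    by (simp add: beta_t_eq)
qed

lemma beta_le_beta_t: "t \<ge> 1 \<Longrightarrow> beta D \<le> beta_t D t"
  unfolding beta_def
  by (rule cINF_lower) (auto intro!: bdd_belowI[of _ 0] simp: beta_t_eq)

lemma beta_le_optimal_length: "t \<ge> 1 \<Longrightarrow> real t * beta D \<le> real (optimal_length D t)"
  using beta_le_beta_t[of t D] by (simp add: beta_t_eq field_simps)

lemma le_betaI: "(\<And>t. t \<ge> 1 \<Longrightarrow> c \<le> beta_t D t) \<Longrightarrow> c \<le> beta D"
  unfolding beta_def by (rule cINF_greatest) auto

lemma ex_beta_t_less:
  assumes "e > 0"
  shows "\<exists>t\<ge>1. beta_t D t < beta D + e"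
proof (rule ccontr)
  assume "\<not> ?thesis"
  then have "beta D + e \<le> beta D"
    by (intro le_betaI) force
  with assms show False by simp
qed

section \<open>Independent sets of the confusion graph\<close>

definition independent :: "('a, 'b) pre_digraph \<Rightarrow> nat \<Rightarrow> ('a \<Rightarrow> bool list) set \<Rightarrow> bool" where
  "independent D t S \<longleftrightarrow> S \<subseteq> realizations (verts D) t \<and> (\<forall>x\<in>S. \<forall>y\<in>S. \<not> confusable D x y)"

text \<open>On booleans \<open>\<noteq>\<close> is exclusive or, so this is addition in the
  realizations over \<open>V\<close>, seen as a vector space over the two-element field.\<close>

definition translate :: "'a set \<Rightarrow> ('a \<Rightarrow> bool list) \<Rightarrow> ('a \<Rightarrow> bool list) \<Rightarrow> 'a \<Rightarrow> bool list" where
  "translate V x a = (\<lambda>i\<in>V. map2 (\<noteq>) (x i) (a i))"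

lemma map2_neq_cancel: "length u = length v \<Longrightarrow> map2 (\<noteq>) u (map2 (\<noteq>) u v) = v"
  by (rule nth_equalityI) auto

lemma map2_neq_inj:
  fixes u v w :: "bool list"
  shows "length u = length w \<Longrightarrow> length v = length w \<Longrightarrow> map2 (\<noteq>) u w = map2 (\<noteq>) v w \<Longrightarrow> u = v"
proof (rule nth_equalityI)
  assume len: "length u = length w" "length v = length w" and eq: "map2 (\<noteq>) u w = map2 (\<noteq>) v w"
  then show "length u = length v" by simp
  fix i assume "i < length u"
  with len have "map2 (\<noteq>) u w ! i = (u ! i \<noteq> w ! i)" "map2 (\<noteq>) v w ! i = (v ! i \<noteq> w ! i)"
    by simp_all
  with eq have "(u ! i \<noteq> w ! i) = (v ! i \<noteq> w ! i)" by metis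
  then show "u ! i = v ! i" by auto
qed

lemma translate_realizations:
  "x \<in> realizations V t \<Longrightarrow> a \<in> realizations V t \<Longrightarrow> translate V x a \<in> realizations V t"
  using length_realizations[of x V t] length_realizations[of a V t]
  by (auto simp: translate_def realizations_def[of _ t] bits_def)

lemma translate_cancel:
  assumes "x \<in> realizations V t" "a \<in> realizations V t"
  shows "translate V x (translate V x a) = a"
proof
  fix i show "translate V x (translate V x a) i = a i"
  proof (cases "i \<in> V")
    case True
    then have "length (x i) = length (a i)"
      using assms by (simp add: length_realizations)
    then show ?thesis
      using True map2_neq_cancel[of "x i" "a i"] by (simp only: translate_def restrict_apply' if_True)
  next
    case False
    then show ?thesis
      using realizations_outside[OF assms(2)] by (simp add: translate_def)
  qed
qed

text \<open>Adding the same \<open>a\<close> changes neither where two realizations agree nor where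
  they differ, and confusability depends on nothing else.\<close>

lemma confusable_translate:
  assumes "x \<in> realizations (verts D) t" "y \<in> realizations (verts D) t" "a \<in> realizations (verts D) t"
    and "confusable D x y"
  shows "confusable D (translate (verts D) x a) (translate (verts D) y a)"
proof -
  obtain r where r: "r \<in> verts D" "x r \<noteq> y r" "\<forall>j\<in>out_neighborhood D r. x j = y j"
    using assms(4) unfolding confusable_def by blast
  have "translate (verts D) x a r \<noteq> translate (verts D) y a r"
    using r(1,2) map2_neq_inj[of "x r" "a r" "y r"] assms(1-3)
    by (auto simp: translate_def length_realizations)
  moreover have "\<forall>j\<in>out_neighborhood D r. translate (verts D) x a j = translate (verts D) y a j"
    using r(3) by (auto simp: translate_def restrict_def)
  ultimately show ?thesis
    using r(1) unfolding confusable_def by blast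
qed

text \<open>Addition of \<open>x\<close> is an involution. That the count is the same for all
  \<open>x\<close> supplies the constant degree \<open>s\<close> in
  \<open>greedy_cover\<close>.\<close>

lemma card_translates:
  assumes "x \<in> realizations V t" "S \<subseteq> realizations V t"
  shows "card {a \<in> realizations V t. translate V x a \<in> S} = card S"
proof (rule bij_betw_same_card)
  show "bij_betw (translate V x) {a \<in> realizations V t. translate V x a \<in> S} S"
    by (rule bij_betw_byWitness[where f' = "translate V x"])
      (use assms translate_cancel[OF assms(1)] translate_realizations[OF assms(1)] in
        \<open>auto simp: subset_iff\<close>)
qed

text \<open>By averaging, some element of \<open>A\<close> covers at least the fraction
  \<open>s / card A\<close> of the points still uncovered, so each greedy choice shrinks the
  uncovered set at least by the factor \<open>1 - s / card A\<close>.\<close>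

lemma greedy_cover:
  fixes s m :: nat
  assumes "finite X" "finite A" "A \<noteq> {}"
    and deg: "\<And>x. x \<in> X \<Longrightarrow> card {a \<in> A. P x a} = s"
  shows "\<exists>B\<subseteq>A. card B \<le> m \<and>
    real (card {x \<in> X. \<forall>a\<in>B. \<not> P x a}) \<le> real (card X) * (1 - real s / real (card A)) ^ m"
proof (induction m)
  case 0
  then show ?case by (intro exI[of _ "{}"]) simp
next
  case (Suc m)
  then obtain B where B: "B \<subseteq> A" "card B \<le> m"
    "real (card {x \<in> X. \<forall>a\<in>B. \<not> P x a}) \<le> real (card X) * (1 - real s / real (card A)) ^ m"
    by blast
  define U where "U = {x \<in> X. \<forall>a\<in>B. \<not> P x a}"
  have finU: "finite U" using assms(1) unfolding U_def by simp
  have cA: "card A > 0" using assms(2,3) by (simp add: card_gt_0_iff)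
  \<comment> \<open>Double counting of the pairs of an uncovered point \<open>x\<close> and an
    \<open>a\<close> with \<open>P x a\<close>.\<close>
  have "(\<Sum>a\<in>A. card {x \<in> U. P x a}) = (\<Sum>a\<in>A. \<Sum>x\<in>U. if P x a then 1 else 0)"
    using finU by (simp add: sum.If_cases Int_def)
  also have "\<dots> = (\<Sum>x\<in>U. \<Sum>a\<in>A. if P x a then 1 else 0)"
    by (rule sum.swap)
  also have "\<dots> = (\<Sum>x\<in>U. card {a \<in> A. P x a})"
    using assms(2) by (simp add: sum.If_cases Int_def)
  also have "\<dots> = card U * s"
    using deg by (simp add: U_def)
  finally have total: "(\<Sum>a\<in>A. card {x \<in> U. P x a}) = card U * s" .
  have "\<exists>a\<in>A. card U * s \<le> card A * card {x \<in> U. P x a}"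
  proof (rule ccontr)
    assume "\<not> ?thesis"
    then have "(\<Sum>a\<in>A. card A * card {x \<in> U. P x a}) < (\<Sum>a\<in>A. card U * s)"
      using assms(2,3) by (intro sum_strict_mono) auto
    then show False
      using total by (simp add: sum_distrib_left[symmetric])
  qed
  then obtain a where a: "a \<in> A" "card U * s \<le> card A * card {x \<in> U. P x a}" by blast
  have "{x \<in> X. \<forall>a\<in>insert a B. \<not> P x a} = U - {x \<in> U. P x a}"
    unfolding U_def by auto
  then have "real (card {x \<in> X. \<forall>a\<in>insert a B. \<not> P x a}) = real (card U) - real (card {x \<in> U. P x a})"
    using finU by (simp add: card_Diff_subset card_mono of_nat_diff)
  also have "real (card {x \<in> U. P x a}) \<ge> real (card U) * (real s / real (card A))"
    using a(2) cA by (simp add: field_simps flip: of_nat_mult)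
  then have "real (card U) - real (card {x \<in> U. P x a}) \<le> real (card U) * (1 - real s / real (card A))"
    by (simp add: algebra_simps)
  also have "\<dots> \<le> (real (card X) * (1 - real s / real (card A)) ^ m) * (1 - real s / real (card A))"
  \<comment> \<open>Multiplying the induction hypothesis by the factor requires it to be
    nonnegative; the degree of any point of \<open>X\<close> gives
    \<open>s \<le> card A\<close>.\<close>
  proof (cases "X = {}")
    case True
    then show ?thesis by (simp add: U_def)
  next
    case False
    then obtain x where "x \<in> X" by blast
    then have "s \<le> card A"
      using deg[of x] card_mono[OF assms(2), of "{a \<in> A. P x a}"] by auto
    then show ?thesis
      using B(3) cA unfolding U_def by (intro mult_right_mono) auto
  qed
  finally have "real (card {x \<in> X. \<forall>a\<in>insert a B. \<not> P x a})
      \<le> real (card X) * (1 - real s / real (card A)) ^ Suc m"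
    by (simp add: mult_ac)
  moreover have "card (insert a B) \<le> Suc m"
    using B(2) card_insert_le_m1[of "Suc m" B a] by simp
  ultimately show ?case
    using a(1) B(1) by (intro exI[of _ "insert a B"]) blast
qed

text \<open>The confusion graph is invariant under translations, so its independent set \<open>S\<close> has
  \<open>|R| / |S| * ln |R|\<close> translates covering all realizations; they are the colors of a code.\<close>

lemma independent_card_bound:
  assumes fin: "finite (verts D)" and t: "t \<ge> 1" and S: "independent D t S"
  shows "real (card S) * 2 ^ optimal_length D t
    \<le> real (card (realizations (verts D) t)) * (2 * (real (card (verts D)) + 1) * real t)"
proof (cases "S = {}")
  case False
  define V where "V = verts D"
  define R where "R = realizations V t"
  define \<rho> where "\<rho> = real (card R)"
  define \<sigma> where "\<sigma> = real (card S)"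
  define n where "n = real (card V)"
  have finR: "finite R" and SR: "S \<subseteq> R"
    using finite_realizations fin S unfolding R_def V_def independent_def by auto
  have \<sigma>: "\<sigma> \<ge> 1" "\<sigma> \<le> \<rho>"
    using False SR finR card_mono[OF finR SR] finite_subset[OF SR finR]
    by (auto simp: \<sigma>_def \<rho>_def Suc_le_eq card_gt_0_iff)
  have ln\<rho>: "ln \<rho> \<le> n * t" "ln \<rho> \<ge> 0"
  proof -
    have "ln \<rho> = n * t * ln 2"
      using card_realizations[of V t] fin by (simp add: \<rho>_def R_def V_def n_def ln_realpow)
    also have "\<dots> \<le> n * t * 1"
      using ln_2_less_1 by (intro mult_left_mono) (auto simp: n_def)
    finally show "ln \<rho> \<le> n * t" by simp
  qed (use \<sigma> in simp)
  \<comment> \<open>The least integer strictly above \<open>\<rho> / \<sigma> * ln \<rho>\<close>: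
    so many translates leave fewer than one realization uncovered.\<close>
  define m where "m = nat \<lfloor>\<rho> / \<sigma> * ln \<rho>\<rfloor> + 1"
  have m: "\<rho> / \<sigma> * ln \<rho> < real m" "real m \<le> \<rho> / \<sigma> * ln \<rho> + 1"
  proof -
    have "0 \<le> \<rho> / \<sigma> * ln \<rho>" using \<sigma> ln\<rho> by simp
    then show "\<rho> / \<sigma> * ln \<rho> < real m" "real m \<le> \<rho> / \<sigma> * ln \<rho> + 1"
      unfolding m_def by linarith+
  qed
  have "\<exists>B\<subseteq>R. card B \<le> m \<and>
    real (card {x \<in> R. \<forall>a\<in>B. \<not> translate V x a \<in> S}) \<le> real (card R) * (1 - real (card S) / real (card R)) ^ m"
    by (rule greedy_cover[OF finR finR])
      (use card_translates[of _ V t S] SR realizations_nonempty in \<open>auto simp: R_def\<close>)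
  then obtain B where B: "B \<subseteq> R" "card B \<le> m"
    "real (card {x \<in> R. \<forall>a\<in>B. \<not> translate V x a \<in> S}) \<le> \<rho> * (1 - \<sigma> / \<rho>) ^ m"
    unfolding \<rho>_def \<sigma>_def by blast
  \<comment> \<open>By \<open>1 - u \<le> exp (- u)\<close> the bound on the number of uncovered
    realizations drops below 1, so this number is 0.\<close>
  have "\<rho> * (1 - \<sigma> / \<rho>) ^ m \<le> \<rho> * exp (- \<sigma> / \<rho>) ^ m"
    using \<sigma> exp_ge_add_one_self[of "- \<sigma> / \<rho>"] by (intro mult_left_mono power_mono) auto
  also have "\<dots> = \<rho> * exp (- (m * \<sigma> / \<rho>))"
    by (simp add: exp_of_nat_mult[symmetric])
  also have "\<dots> < \<rho> * exp (- ln \<rho>)"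
    using m(1) \<sigma> by (simp add: field_simps)
  also have "\<dots> = 1"
    using \<sigma> by (simp add: exp_minus)
  finally have "card {x \<in> R. \<forall>a\<in>B. \<not> translate V x a \<in> S} = 0"
    using B(3) by linarith
  then have cover: "\<exists>a\<in>B. translate V x a \<in> S" if "x \<in> R" for x
    using that finR by auto
  \<comment> \<open>The color of \<open>x\<close> is a translation from the cover that moves
    \<open>x\<close> into \<open>S\<close>. Confusable realizations of one color would be moved to
    confusable elements of the independent set.\<close>
  define c where "c x = (SOME a. a \<in> B \<and> translate V x a \<in> S)" for x
  have c: "c x \<in> B \<and> translate V x (c x) \<in> S" if "x \<in> R" for x
    using cover[OF that] someI_ex[of "\<lambda>a. a \<in> B \<and> translate V x a \<in> S"] unfolding c_def by blast
  have sep: "separating D t c"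
    unfolding separating_def
  proof (intro ballI impI notI)
    fix x y assume xy: "x \<in> realizations (verts D) t" "y \<in> realizations (verts D) t"
      and "confusable D x y" and eq: "c x = c y"
    moreover have "c x \<in> realizations (verts D) t"
      using c[of x] xy(1) B(1) by (auto simp: R_def V_def)
    ultimately have "confusable D (translate V x (c x)) (translate V y (c x))"
      unfolding V_def by (intro confusable_translate)
    then show False
      using c[of x] c[of y] xy eq S unfolding independent_def R_def V_def by auto
  qed
  have le: "optimal_length D t \<le> p" if "m \<le> 2 ^ p" for p
  proof -
    have "\<exists>F. F \<in> realizations (verts D) t \<rightarrow> bits p \<and> separating D t F"
      by (rule coloring_imp_code[OF finite_subset[OF B(1) finR], of _ c])
        (use B(2) that c sep in \<open>auto simp: R_def V_def\<close>)
    then show ?thesis using optimal_length_le by blast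
  qed
  \<comment> \<open>Rounding \<open>m\<close> up to a power of two costs at most a factor 2, since a
    code one bit shorter would have fewer than \<open>m\<close> words.\<close>
  have "2 ^ optimal_length D t \<le> 2 * m"
  proof (cases "optimal_length D t")
    case 0
    then show ?thesis by (simp add: m_def)
  next
    case (Suc k)
    then have "\<not> m \<le> 2 ^ k" using le[of k] by auto
    then show ?thesis by (simp add: Suc)
  qed
  then have "real (2 ^ optimal_length D t) \<le> real (2 * m)"
    by (simp only: of_nat_le_iff)
  then have "\<sigma> * 2 ^ optimal_length D t \<le> \<sigma> * (2 * real m)"
    using \<sigma> by (intro mult_left_mono) simp_all
  also have "\<dots> \<le> \<sigma> * (2 * (\<rho> / \<sigma> * ln \<rho> + 1))"
    using m(2) \<sigma> by simp
  also have "\<dots> = 2 * (\<rho> * ln \<rho> + \<sigma>)"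
    using \<sigma> by (simp add: field_simps)
  \<comment> \<open>Here \<open>t \<ge> 1\<close> enters: the summand \<open>\<sigma>\<close>, which
    stems from rounding, is absorbed in \<open>\<rho> * t\<close>.\<close>
  also have "\<dots> \<le> 2 * (\<rho> * (n * t) + \<rho> * t)"
  proof -
    have "\<sigma> \<le> \<rho> * t" using \<sigma> t mult_mono[of \<sigma> \<rho> 1 "real t"] by simp
    then show ?thesis using ln\<rho>(1) \<sigma> by (intro mult_left_mono add_mono) auto
  qed
  finally show ?thesis
    by (simp add: \<sigma>_def \<rho>_def R_def V_def n_def algebra_simps)
qed simp

section \<open>The lower bound\<close>

lemma out_neighborhood_induce:
  "r \<in> A \<Longrightarrow> out_neighborhood (D \<restriction> A) r = out_neighborhood D r \<inter> A"
  unfolding out_neighborhood_def arcs_ends_def arc_to_ends_def induce_subgraph_def by auto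

text \<open>Messages outside \<open>A\<close> and \<open>B\<close> are frozen to the zero word, so
  they never distinguish two merged realizations.\<close>

definition merge :: "'a set \<Rightarrow> 'a set \<Rightarrow> 'a set \<Rightarrow> nat \<Rightarrow>
    ('a \<Rightarrow> bool list) \<Rightarrow> ('a \<Rightarrow> bool list) \<Rightarrow> 'a \<Rightarrow> bool list" where
  "merge V A B t a b = (\<lambda>i\<in>V. if i \<in> A then a i else if i \<in> B then b i else replicate t False)"

lemma merge_realizations:
  "a \<in> realizations A t \<Longrightarrow> b \<in> realizations B t \<Longrightarrow> merge V A B t a b \<in> realizations V t"
  unfolding realizations_def merge_def bits_def by auto

text \<open>A class of realizations with equal codewords, restricted to \<open>A \<union> B\<close>, projects to an
  independent set of \<open>D \<restriction> A\<close> whose fibers are independent sets of \<open>D \<restriction> B\<close>.\<close>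

lemma optimal_length_induced_add_le:
  assumes fin: "finite (verts D)" and t: "t \<ge> 1"
    and A: "A \<subseteq> verts D" and B: "B \<subseteq> verts D" and AB: "A \<inter> B = {}"
    and noarc: "\<And>u v. u \<in> A \<Longrightarrow> v \<in> B \<Longrightarrow> \<not> u \<rightarrow>\<^bsub>D\<^esub> v"
  shows "(2::real) ^ (optimal_length (D \<restriction> A) t + optimal_length (D \<restriction> B) t)
    \<le> 2 ^ optimal_length D t * (2 * (real (card (verts D)) + 1) * real t)\<^sup>2"
proof -
  define K where "K = 2 * (real (card (verts D)) + 1) * real t"
  have K: "K \<ge> 0" unfolding K_def by simp
  define RA where "RA = realizations A t"
  define RB where "RB = realizations B t"
  have finA: "finite A" "finite B" using fin A B finite_subset by blast+
  have fR: "finite RA" "finite RB"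
    unfolding RA_def RB_def using finA finite_realizations by blast+
  have pos: "card RA > 0" "card RB > 0"
    using fR realizations_nonempty by (auto simp: card_gt_0_iff RA_def RB_def)
  let ?l = "optimal_length D t" and ?lA = "optimal_length (D \<restriction> A) t"
    and ?lB = "optimal_length (D \<restriction> B) t"
  obtain F where F: "F \<in> realizations (verts D) t \<rightarrow> bits ?l" "separating D t F"
    using optimal_code[OF fin] .
  let ?m = "merge (verts D) A B t"
  have m: "?m a b \<in> realizations (verts D) t" if "a \<in> RA" "b \<in> RB" for a b
    using that merge_realizations unfolding RA_def RB_def by blast
  \<comment> \<open>The polynomial factor is enlarged to the one for all of \<open>D\<close>, so
    that both parts share the same \<open>K\<close>.\<close>
  have indep_bound: "real (card S) \<le> real (card (realizations C t)) * K / 2 ^ optimal_length (D \<restriction> C) t"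
    if "independent (D \<restriction> C) t S" "C \<subseteq> verts D" for C S
  proof -
    have fC: "finite C" using that(2) fin finite_subset by blast
    have "real (card S) * 2 ^ optimal_length (D \<restriction> C) t
      \<le> real (card (realizations C t)) * (2 * (real (card C) + 1) * real t)"
      using independent_card_bound[OF _ t that(1)] fC by simp
    also have "\<dots> \<le> real (card (realizations C t)) * K"
      using card_mono[OF fin that(2)] unfolding K_def
      by (intro mult_left_mono mult_right_mono) auto
    finally show ?thesis by (simp add: field_simps)
  qed
  define T where "T c = {a \<in> RA. \<exists>b\<in>RB. F (?m a b) = c}" for c
  define Q where "Q c a = {b \<in> RB. F (?m a b) = c}" for c a
  \<comment> \<open>The witnesses \<open>b\<close> and \<open>b'\<close> may differ, but a receiver
    in \<open>A\<close> has no arc into \<open>B\<close>, so its side information does not reveal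
    this.\<close>
  have T: "independent (D \<restriction> A) t (T c)" for c
    unfolding independent_def
  proof (intro conjI ballI notI)
    show "T c \<subseteq> realizations (verts (D \<restriction> A)) t" by (auto simp: T_def RA_def)
  next
    fix a a' assume "a \<in> T c" "a' \<in> T c" and conf: "confusable (D \<restriction> A) a a'"
    then obtain b b' where ab: "a \<in> RA" "a' \<in> RA" "b \<in> RB" "b' \<in> RB" "F (?m a b) = c" "F (?m a' b') = c"
      unfolding T_def by blast
    obtain r where r: "r \<in> A" "a r \<noteq> a' r" "\<forall>j\<in>out_neighborhood D r \<inter> A. a j = a' j"
      using conf unfolding confusable_def by (auto simp: out_neighborhood_induce)
    have "\<not> confusable D (?m a b) (?m a' b')"
      using separatingD[OF F(2) m[OF ab(1,3)] m[OF ab(2,4)]] ab(5,6) by simp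
    moreover have "?m a b r \<noteq> ?m a' b' r"
      using r A by (auto simp: merge_def)
    moreover have "\<forall>j\<in>out_neighborhood D r. ?m a b j = ?m a' b' j"
      using r noarc[OF r(1)] by (auto simp: merge_def restrict_def out_neighborhood_def)
    ultimately show False
      using r(1) A unfolding confusable_def by blast
  qed
  \<comment> \<open>With \<open>a\<close> fixed, a receiver in \<open>B\<close> may have arcs into
    \<open>A\<close>: the two realizations agree there.\<close>
  have Q: "independent (D \<restriction> B) t (Q c a)" if a: "a \<in> RA" for c a
    unfolding independent_def
  proof (intro conjI ballI notI)
    show "Q c a \<subseteq> realizations (verts (D \<restriction> B)) t" by (auto simp: Q_def RB_def)
  next
    fix b b' assume b: "b \<in> Q c a" "b' \<in> Q c a" and conf: "confusable (D \<restriction> B) b b'"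
    obtain r where r: "r \<in> B" "b r \<noteq> b' r" "\<forall>j\<in>out_neighborhood D r \<inter> B. b j = b' j"
      using conf unfolding confusable_def by (auto simp: out_neighborhood_induce)
    have "\<not> confusable D (?m a b) (?m a b')"
      using separatingD[OF F(2) m[OF a, of b] m[OF a, of b']] b by (simp add: Q_def)
    moreover have "?m a b r \<noteq> ?m a b' r"
      using r B AB by (auto simp: merge_def)
    moreover have "\<forall>j\<in>out_neighborhood D r. ?m a b j = ?m a b' j"
      using r by (auto simp: merge_def restrict_def)
    ultimately show False
      using r(1) B unfolding confusable_def by blast
  qed
  have fiber: "real (card (Sigma (T c) (Q c)))
      \<le> (real (card RA) * K / 2 ^ ?lA) * (real (card RB) * K / 2 ^ ?lB)" for c
  proof -
    have "real (card (Sigma (T c) (Q c))) = (\<Sum>a\<in>T c. real (card (Q c a)))"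
      using fR by (subst card_SigmaI) (auto simp: T_def Q_def)
    also have "\<dots> \<le> real (card (T c)) * (real (card RB) * K / 2 ^ ?lB)"
      using indep_bound[OF Q B] by (intro sum_bounded_above) (auto simp: T_def RB_def)
    also have "\<dots> \<le> (real (card RA) * K / 2 ^ ?lA) * (real (card RB) * K / 2 ^ ?lB)"
      using indep_bound[OF T A] K by (intro mult_right_mono) (auto simp: RA_def)
    finally show ?thesis .
  qed
  \<comment> \<open>Every pair lies in the class of its codeword, so \<open>2 ^ ?l\<close> classes
    of bounded size exhaust the product.\<close>
  have "RA \<times> RB \<subseteq> (\<Union>c\<in>bits ?l. Sigma (T c) (Q c))"
    using m funcset_mem[OF F(1)] by (fastforce simp: T_def Q_def)
  then have "card (RA \<times> RB) \<le> card (\<Union>c\<in>bits ?l. Sigma (T c) (Q c))"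
    by (rule card_mono[rotated]) (use fR in \<open>auto simp: finite_bits T_def Q_def\<close>)
  also have "\<dots> \<le> (\<Sum>c\<in>bits ?l. card (Sigma (T c) (Q c)))"
    by (rule card_UN_le[OF finite_bits])
  finally have "real (card RA * card RB) \<le> (\<Sum>c\<in>bits ?l. real (card (Sigma (T c) (Q c))))"
    by (simp only: card_cartesian_product of_nat_le_iff flip: of_nat_sum)
  also have "\<dots> \<le> real (card (bits ?l)) * ((real (card RA) * K / 2 ^ ?lA) * (real (card RB) * K / 2 ^ ?lB))"
    by (rule sum_bounded_above) (rule fiber)
  finally have "real (card RA) * real (card RB) * 2 ^ (?lA + ?lB)
      \<le> real (card RA) * real (card RB) * (2 ^ ?l * K\<^sup>2)"
    by (simp add: card_bits field_simps power_add power2_eq_square)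
  then show ?thesis
    using pos by (simp add: K_def)
qed

text \<open>Taking logarithms, the polynomial loss becomes \<open>2 * log 2 (c * s) / s\<close>.
  Along the multiples \<open>s = k * t\<close> it tends to 0, while the rate of \<open>D\<close>
  stays at most \<open>beta_t D t\<close>.\<close>

lemma beta_induced_add_le:
  assumes fin: "finite (verts D)"
    and A: "A \<subseteq> verts D" and B: "B \<subseteq> verts D" and AB: "A \<inter> B = {}"
    and noarc: "\<And>u v. u \<in> A \<Longrightarrow> v \<in> B \<Longrightarrow> \<not> u \<rightarrow>\<^bsub>D\<^esub> v"
  shows "beta (D \<restriction> A) + beta (D \<restriction> B) \<le> beta D"
proof (rule le_betaI)
  fix t :: nat assume t: "t \<ge> 1"
  define c where "c = 2 * (real (card (verts D)) + 1)"
  have c: "c > 0" unfolding c_def by simp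
  have bound: "beta (D \<restriction> A) + beta (D \<restriction> B) \<le> beta_t D t + 2 * log 2 (c * real (k * t)) / real (k * t)"
    if k: "k \<ge> 1" for k
  proof -
    define s where "s = k * t"
    have s: "s \<ge> 1" using k t by (simp add: s_def)
    have pos: "c * real s > 0" using c s by simp
    have "log 2 (2 ^ (optimal_length (D \<restriction> A) s + optimal_length (D \<restriction> B) s))
        \<le> log 2 (2 ^ optimal_length D s * (c * real s)\<^sup>2)"
      using optimal_length_induced_add_le[OF fin s A B AB noarc] zero_less_power[OF pos, of 2]
      by (intro log_mono) (simp_all only: c_def[symmetric], simp_all)
    moreover have "log 2 (2 ^ optimal_length D s * (c * real s)\<^sup>2)
        = real (optimal_length D s) + 2 * log 2 (c * real s)"
      using log_mult_pos[of "2 ^ optimal_length D s" "(c * real s)\<^sup>2" 2] zero_less_power[OF pos, of 2]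
      by (simp only: log_nat_power[OF less_imp_le[OF pos]]) simp
    ultimately have "real (optimal_length (D \<restriction> A) s) + real (optimal_length (D \<restriction> B) s)
        \<le> real (optimal_length D s) + 2 * log 2 (c * real s)"
      by simp
    then have "real s * (beta (D \<restriction> A) + beta (D \<restriction> B)) \<le> real (optimal_length D s) + 2 * log 2 (c * real s)"
      using beta_le_optimal_length[OF s, of "D \<restriction> A"] beta_le_optimal_length[OF s, of "D \<restriction> B"]
      by (simp add: distrib_left)
    then have "beta (D \<restriction> A) + beta (D \<restriction> B) \<le> beta_t D s + 2 * log 2 (c * real s) / real s"
      using s by (simp add: beta_t_eq field_simps)
    also have "beta_t D s \<le> beta_t D t"
      unfolding s_def by (rule beta_t_mult_le[OF fin k])
    finally show ?thesis by (simp add: s_def)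
  qed
  have "filterlim (\<lambda>k. k * t) at_top at_top"
    using t by (intro filterlim_at_top_mono[OF filterlim_ident] always_eventually) auto
  moreover have "((\<lambda>s. 2 * log 2 (c * real s) / real s) \<longlongrightarrow> 0) at_top"
    using c by real_asymp
  ultimately have "((\<lambda>k. 2 * log 2 (c * real (k * t)) / real (k * t)) \<longlongrightarrow> 0) at_top"
    by (rule filterlim_compose[rotated])
  then have "((\<lambda>k. beta_t D t + 2 * log 2 (c * real (k * t)) / real (k * t)) \<longlongrightarrow> beta_t D t + 0) at_top"
    by (intro tendsto_intros)
  then show "beta (D \<restriction> A) + beta (D \<restriction> B) \<le> beta_t D t"
    using bound by (intro LIMSEQ_le_const) auto
qed

section \<open>Two senders\<close>

definition two_sender_length :: "('a, 'b) pre_digraph \<Rightarrow> 'a set \<Rightarrow> 'a set \<Rightarrow> nat \<Rightarrow> nat" where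
  "two_sender_length D M1 M2 t = (LEAST p. \<exists>p1 p2 F1 F2 G. p = p1 + p2 \<and>
       two_sender_index_code D M1 M2 t p1 p2 F1 F2 G)"

lemma two_sender_beta_t_eq:
  "two_sender_beta_t D M1 M2 t = real (two_sender_length D M1 M2 t) / real t"
  unfolding two_sender_beta_t_def two_sender_length_def ..

lemma two_sender_beta_le:
  "t \<ge> 1 \<Longrightarrow> two_sender_beta D M1 M2 \<le> two_sender_beta_t D M1 M2 t"
  unfolding two_sender_beta_def
  by (rule cINF_lower) (auto intro!: bdd_belowI[of _ 0] simp: two_sender_beta_t_eq)

lemma ex_two_sender_index_code:
  assumes "F1 \<in> realizations M1 t \<rightarrow> bits p1" "F2 \<in> realizations M2 t \<rightarrow> bits p2"
    and "separating D t (\<lambda>x. (F1 (restrict x M1), F2 (restrict x M2)))"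
  shows "\<exists>G. two_sender_index_code D M1 M2 t p1 p2 F1 F2 G"
proof -
  obtain G where G: "\<forall>x\<in>realizations (verts D) t. \<forall>r\<in>verts D.
      G r (F1 (restrict x M1), F2 (restrict x M2)) (restrict x (out_neighborhood D r)) = x r"
    using separating_imp_decoder[OF assms(3)] by blast
  have "two_sender_index_code D M1 M2 t p1 p2 F1 F2 (\<lambda>r u v. G r (u, v))"
    using assms(1,2) G unfolding two_sender_index_code_def by blast
  then show ?thesis by blast
qed

text \<open>A single sender can transmit both sub-codewords in sequence; the decoder splits after
  \<open>p1\<close> bits.\<close>

lemma optimal_length_le_two_sender:
  assumes "two_sender_index_code D M1 M2 t p1 p2 F1 F2 G" "M1 \<subseteq> verts D" "M2 \<subseteq> verts D"
  shows "optimal_length D t \<le> p1 + p2"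
proof -
  let ?F = "\<lambda>x. F1 (restrict x M1) @ F2 (restrict x M2)"
  have F: "F1 (restrict x M1) \<in> bits p1" "F2 (restrict x M2) \<in> bits p2"
    if "x \<in> realizations (verts D) t" for x
    using that assms restrict_realizations[of x "verts D" t]
    unfolding two_sender_index_code_def by blast+
  have "index_code D t (p1 + p2) ?F (\<lambda>r w s. G r (take p1 w) (drop p1 w) s)"
    using assms(1) F unfolding index_code_def two_sender_index_code_def by (auto simp: bits_def)
  then show ?thesis
    using ex_index_code_iff optimal_length_le by blast
qed

text \<open>Positions past the end of a word count as zero, so codewords of different lengths can be
  added.\<close>

definition padded_xor :: "nat \<Rightarrow> bool list \<Rightarrow> bool list \<Rightarrow> bool list" where
  "padded_xor m u v = map (\<lambda>i. (i < length u \<and> u ! i) \<noteq> (i < length v \<and> v ! i)) [0..<m]"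

lemma padded_xor_bits: "padded_xor m u v \<in> bits m"
  by (simp add: padded_xor_def bits_def)

text \<open>Because \<open>n \<le> m\<close>, no bit of \<open>v\<close> is cut off, and a known
  summand can be removed.\<close>

lemma padded_xor_cancel:
  assumes "padded_xor m u v = padded_xor m u v'" "v \<in> bits n" "v' \<in> bits n" "n \<le> m"
  shows "v = v'"
proof (rule nth_equalityI)
  show "length v = length v'" using assms(2,3) by (simp add: bits_def)
next
  fix i assume "i < length v"
  then have i: "i < length v" "i < length v'" "i < m"
    using assms(2-4) by (auto simp: bits_def)
  have "padded_xor m u v ! i = padded_xor m u v' ! i" using assms(1) by simp
  then show "v ! i = v' ! i" using i unfolding padded_xor_def by auto
qed

lemma padded_xor_commute: "padded_xor m u v = padded_xor m v u"
  unfolding padded_xor_def by auto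

text \<open>Sender 1 sends \<open>C1 \<oplus> C3\<close> and sender 2 sends \<open>C2 \<oplus> C3\<close>, where \<open>Ci\<close> is the codeword for
  the \<open>i\<close>-th part. A receiver in any part knows all of part 1 or all of part 2, hence
  \<open>C1\<close> or \<open>C2\<close>, hence \<open>C3\<close>, and with it all three codewords.\<close>

lemma two_sender_code_exists:
  assumes fin: "finite (verts D)" and V: "verts D = M1 \<union> M2"
    and k12: "\<And>u v. u \<in> M1 - M2 \<Longrightarrow> v \<in> M2 - M1 \<Longrightarrow> u \<rightarrow>\<^bsub>D\<^esub> v"
    and k21: "\<And>u v. u \<in> M2 - M1 \<Longrightarrow> v \<in> M1 - M2 \<Longrightarrow> u \<rightarrow>\<^bsub>D\<^esub> v"
    and k3: "(\<forall>u\<in>M1 \<inter> M2. \<forall>v\<in>M1 - M2. u \<rightarrow>\<^bsub>D\<^esub> v) \<or> (\<forall>u\<in>M1 \<inter> M2. \<forall>v\<in>M2 - M1. u \<rightarrow>\<^bsub>D\<^esub> v)"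
  defines "l1 \<equiv> optimal_length (D \<restriction> (M1 - M2))" and "l2 \<equiv> optimal_length (D \<restriction> (M2 - M1))"
    and "l3 \<equiv> optimal_length (D \<restriction> (M1 \<inter> M2))"
  shows "\<exists>F1 F2 G. two_sender_index_code D M1 M2 t
           (max (l1 t) (l3 t)) (max (l2 t) (l3 t)) F1 F2 G"
proof -
  define P1 where "P1 = M1 - M2"
  define P2 where "P2 = M2 - M1"
  define P3 where "P3 = M1 \<inter> M2"
  have P: "P1 \<subseteq> M1" "P3 \<subseteq> M1" "P2 \<subseteq> M2" "P3 \<subseteq> M2" "verts D = P1 \<union> P2 \<union> P3"
    using V unfolding P1_def P2_def P3_def by auto
  have finP: "finite (verts (D \<restriction> P1))" "finite (verts (D \<restriction> P2))" "finite (verts (D \<restriction> P3))"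
    using fin P(5) by auto
  obtain C1 where C1: "C1 \<in> realizations P1 t \<rightarrow> bits (l1 t)" "separating (D \<restriction> P1) t C1"
    using optimal_code[OF finP(1)] unfolding l1_def P1_def by auto
  obtain C2 where C2: "C2 \<in> realizations P2 t \<rightarrow> bits (l2 t)" "separating (D \<restriction> P2) t C2"
    using optimal_code[OF finP(2)] unfolding l2_def P2_def by auto
  obtain C3 where C3: "C3 \<in> realizations P3 t \<rightarrow> bits (l3 t)" "separating (D \<restriction> P3) t C3"
    using optimal_code[OF finP(3)] unfolding l3_def P3_def by auto
  define F1 where "F1 x = padded_xor (max (l1 t) (l3 t)) (C1 (restrict x P1)) (C3 (restrict x P3))" for x
  define F2 where "F2 x = padded_xor (max (l2 t) (l3 t)) (C2 (restrict x P2)) (C3 (restrict x P3))" for x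
  have restr: "F1 (restrict x M1) = F1 x" "F2 (restrict x M2) = F2 x" for x
    using P(1-4) by (simp_all add: F1_def F2_def Int_absorb1)
  have notconf: "\<not> confusable (D \<restriction> Q) (restrict x Q) (restrict y Q)"
    if "separating (D \<restriction> Q) t C" "x \<in> realizations (verts D) t" "y \<in> realizations (verts D) t"
      "Q \<subseteq> verts D" "C (restrict x Q) = C (restrict y Q)" for Q x y and C :: "('a \<Rightarrow> bool list) \<Rightarrow> bool list"
    using separatingD[OF that(1), of "restrict x Q" "restrict y Q"] that(2-5)
    by (simp add: restrict_realizations)
  have "separating D t (\<lambda>x. (F1 (restrict x M1), F2 (restrict x M2)))"
    unfolding separating_def
  proof (intro ballI impI notI)
    fix x y assume x: "x \<in> realizations (verts D) t" and y: "y \<in> realizations (verts D) t"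
      and conf: "confusable D x y"
      and "(F1 (restrict x M1), F2 (restrict x M2)) = (F1 (restrict y M1), F2 (restrict y M2))"
    then have F1: "F1 x = F1 y" and F2: "F2 x = F2 y"
      by (simp_all add: restr)
    let ?eq = "\<lambda>C P. C (restrict x P) = C (restrict y P)"
    have bits: "C1 (restrict z P1) \<in> bits (l1 t)" "C2 (restrict z P2) \<in> bits (l2 t)"
      "C3 (restrict z P3) \<in> bits (l3 t)" if "z \<in> realizations (verts D) t" for z
      using C1(1) C2(1) C3(1) restrict_realizations[OF that] P(5) by auto
    \<comment> \<open>Sender 1 transmits the same sum for \<open>x\<close> and \<open>y\<close>, so
      agreement of one summand forces agreement of the other.\<close>
    have e13: "?eq C1 P1 \<longleftrightarrow> ?eq C3 P3"
      using F1 padded_xor_cancel[OF _ bits(3)[OF x] bits(3)[OF y]]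
        padded_xor_cancel[OF _ bits(1)[OF x] bits(1)[OF y]]
      unfolding F1_def by (metis max.cobounded1 max.cobounded2 padded_xor_commute)
    have e23: "?eq C2 P2 \<longleftrightarrow> ?eq C3 P3"
      using F2 padded_xor_cancel[OF _ bits(3)[OF x] bits(3)[OF y]]
        padded_xor_cancel[OF _ bits(2)[OF x] bits(2)[OF y]]
      unfolding F2_def by (metis max.cobounded1 max.cobounded2 padded_xor_commute)
    obtain r where r: "r \<in> verts D" "x r \<noteq> y r" "\<forall>j\<in>out_neighborhood D r. x j = y j"
      using conf unfolding confusable_def by blast
    have known: "restrict x Q = restrict y Q" if "\<forall>v\<in>Q. r \<rightarrow>\<^bsub>D\<^esub> v" for Q
      using r(3) that by (auto simp: restrict_eq_iff out_neighborhood_def)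
    have "restrict x P1 = restrict y P1 \<or> restrict x P2 = restrict y P2"
      using r(1) P(5) known[of P1] known[of P2] k12 k21 k3 unfolding P1_def P2_def P3_def by blast
    then have all_eq: "?eq C1 P1" "?eq C2 P2" "?eq C3 P3"
      using e13 e23 by metis+
    \<comment> \<open>Side information inside a part belongs to the side information in
      \<open>D\<close>, so a confusion at \<open>r\<close> in \<open>D\<close> would persist in the
      part that contains \<open>r\<close>.\<close>
    have "r \<notin> Q" if "\<not> confusable (D \<restriction> Q) (restrict x Q) (restrict y Q)" for Q
      using that r(2,3) unfolding confusable_def by (auto simp: out_neighborhood_induce)
    then show False
      using r(1) P(5) notconf[OF C1(2) x y _ all_eq(1)] notconf[OF C2(2) x y _ all_eq(2)]
        notconf[OF C3(2) x y _ all_eq(3)] by blast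
  qed
  then show ?thesis
    using ex_two_sender_index_code[of F1 M1 t _ F2 M2 _ D]
    unfolding F1_def F2_def by (metis (no_types, lifting) padded_xor_bits Pi_I)
qed

text \<open>The three optimal codes must use one message length. At the product of three nearly
  optimal lengths all three rates are nearly optimal at once.\<close>

lemma two_sender_beta_le_max:
  assumes code: "\<And>t. \<exists>F1 F2 G. two_sender_index_code D M1 M2 t
      (max (optimal_length D1 t) (optimal_length D3 t)) (max (optimal_length D2 t) (optimal_length D3 t)) F1 F2 G"
    and finD: "finite (verts D1)" "finite (verts D2)" "finite (verts D3)"
  shows "two_sender_beta D M1 M2 \<le> max (beta D1) (beta D3) + max (beta D2) (beta D3)"
proof (rule field_le_epsilon)
  fix e :: real assume "e > 0"
  then have e: "e / 2 > 0" by simp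
  obtain t1 t2 t3 where t: "t1 \<ge> 1" "t2 \<ge> 1" "t3 \<ge> 1" "beta_t D1 t1 < beta D1 + e / 2"
    "beta_t D2 t2 < beta D2 + e / 2" "beta_t D3 t3 < beta D3 + e / 2"
    using ex_beta_t_less[OF e] by metis
  define t where "t = t1 * t2 * t3"
  have t1: "t \<ge> 1" using t by (simp add: t_def)
  have "beta_t D1 t \<le> beta_t D1 t1" "beta_t D2 t \<le> beta_t D2 t2" "beta_t D3 t \<le> beta_t D3 t3"
    using beta_t_mult_le[OF finD(1), of "t2 * t3" t1] beta_t_mult_le[OF finD(2), of "t1 * t3" t2]
      beta_t_mult_le[OF finD(3), of "t1 * t2" t3] t(1-3)
    by (simp_all add: t_def mult_ac)
  then have b: "beta_t D1 t \<le> beta D1 + e / 2" "beta_t D2 t \<le> beta D2 + e / 2"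
    "beta_t D3 t \<le> beta D3 + e / 2"
    using t by linarith+
  have "two_sender_beta_t D M1 M2 t
    \<le> real (max (optimal_length D1 t) (optimal_length D3 t) + max (optimal_length D2 t) (optimal_length D3 t)) / real t"
    unfolding two_sender_beta_t_eq two_sender_length_def
    by (intro divide_right_mono of_nat_mono Least_le) (use code[of t] in \<open>blast, simp\<close>)
  also have "\<dots> = max (beta_t D1 t) (beta_t D3 t) + max (beta_t D2 t) (beta_t D3 t)"
    using t1 by (simp add: beta_t_eq add_divide_distrib max_divide_distrib_right of_nat_max)
  also have "\<dots> \<le> max (beta D1) (beta D3) + max (beta D2) (beta D3) + e"
    using b by linarith
  finally show "two_sender_beta D M1 M2 \<le> max (beta D1) (beta D3) + max (beta D2) (beta D3) + e"
    using two_sender_beta_le[OF t1, of D M1 M2] by linarith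
qed

text \<open>Dropping the sender constraint cannot lengthen an optimal code; \<open>code\<close>
  ensures that the minimum defining \<open>two_sender_length\<close> is attained.\<close>

lemma beta_le_two_sender_beta:
  assumes M: "M1 \<subseteq> verts D" "M2 \<subseteq> verts D"
    and code: "\<And>t. \<exists>p1 p2 F1 F2 G. two_sender_index_code D M1 M2 t p1 p2 F1 F2 G"
  shows "beta D \<le> two_sender_beta D M1 M2"
  unfolding two_sender_beta_def
proof (rule cINF_greatest)
  fix t :: nat assume "t \<in> {1..}"
  then have t: "t \<ge> 1" by simp
  have "\<exists>p1 p2 F1 F2 G. two_sender_length D M1 M2 t = p1 + p2 \<and>
       two_sender_index_code D M1 M2 t p1 p2 F1 F2 G"
    unfolding two_sender_length_def by (rule LeastI_ex) (use code[of t] in blast)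
  then have "optimal_length D t \<le> two_sender_length D M1 M2 t"
    using optimal_length_le_two_sender[OF _ M] by metis
  then have "beta_t D t \<le> two_sender_beta_t D M1 M2 t"
    unfolding beta_t_eq two_sender_beta_t_eq by (intro divide_right_mono) auto
  then show "beta D \<le> two_sender_beta_t D M1 M2 t"
    using beta_le_beta_t[OF t, of D] by linarith
qed simp

theorem proposition3:
  fixes N :: nat and D :: "(nat, 'e) pre_digraph" and M1 M2 :: "nat set"
  defines "D1 \<equiv> sub_digraph D M1 M2 1"
    and "D2 \<equiv> sub_digraph D M1 M2 2"
    and "D3 \<equiv> sub_digraph D M1 M2 3"
    and "fD \<equiv> interaction_digraph D M1 M2"
  assumes "digraph D"
    and "verts D = {1..N}"
    and "M1 \<union> M2 = {1..N}"
    and "fully_participated D M1 M2"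
    and "(1, 2) \<in> arcs fD" and "(2, 1) \<in> arcs fD"
    and "(1, 3) \<notin> arcs fD" and "(2, 3) \<notin> arcs fD"
    and "(3, 1) \<in> arcs fD \<or> (3, 2) \<in> arcs fD"
    and "min (beta D1) (beta D2) \<le> beta D3"
    and "beta D3 \<le> max (beta D1) (beta D2)"
  shows "two_sender_beta D M1 M2 = beta D \<and>
         beta D = beta D3 + max (beta D1) (beta D2)"
proof -
  have D: "D1 = D \<restriction> (M1 - M2)" "D2 = D \<restriction> (M2 - M1)" "D3 = D \<restriction> (M1 \<inter> M2)"
    by (simp_all add: D1_def D2_def D3_def sub_digraph_def message_part_def)
  have V: "verts D = M1 \<union> M2" and fin: "finite (verts D)" and M: "M1 \<subseteq> verts D" "M2 \<subseteq> verts D"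
    using assms(6,7) by auto
  have full: "\<forall>u\<in>message_part M1 M2 i. \<forall>v\<in>message_part M1 M2 j. u \<rightarrow>\<^bsub>D\<^esub> v"
    if "(i, j) \<in> arcs fD" for i j
    using that assms(8) unfolding fully_participated_def fD_def by (simp add: sub_digraph_def)
  have none: "\<not> u \<rightarrow>\<^bsub>D\<^esub> v" if "u \<in> message_part M1 M2 i" "v \<in> message_part M1 M2 j"
    "(i, j) \<notin> arcs fD" "i \<in> {1, 2, 3}" "j \<in> {1, 2, 3}" "i \<noteq> j" for i j u v
    using that unfolding fD_def interaction_digraph_def by (auto simp: sub_digraph_def)
  have code: "\<exists>F1 F2 G. two_sender_index_code D M1 M2 t
      (max (optimal_length D1 t) (optimal_length D3 t)) (max (optimal_length D2 t) (optimal_length D3 t)) F1 F2 G" for t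
    unfolding D
    by (rule two_sender_code_exists[OF fin V])
      (use full[OF assms(9)] full[OF assms(10)] full[of 3 1] full[of 3 2] assms(13) in
        \<open>auto simp: message_part_def\<close>)
  have "two_sender_beta D M1 M2 \<le> max (beta D1) (beta D3) + max (beta D2) (beta D3)"
    by (rule two_sender_beta_le_max[OF code]) (use fin V in \<open>auto simp: D\<close>)
  moreover have "beta D \<le> two_sender_beta D M1 M2"
    using beta_le_two_sender_beta[OF M] code by blast
  \<comment> \<open>Parts 1 and 2 have no arcs to part 3, so superadditivity applies to each of them
    together with part 3.\<close>
  moreover have "beta D1 + beta D3 \<le> beta D" "beta D2 + beta D3 \<le> beta D"
    unfolding D
    by (rule beta_induced_add_le[OF fin]; use V none[of _ 1 _ 3] none[of _ 2 _ 3] assms(11,12) in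
        \<open>auto simp: message_part_def\<close>)+
  \<comment> \<open>As \<open>beta D3\<close> lies between the other two rates, one maximum in the
    upper bound is \<open>beta D3\<close> and the other is the larger of \<open>beta D1\<close> and
    \<open>beta D2\<close>, which matches the lower bound.\<close>
  ultimately show ?thesis
    using assms(14,15) by linarith
qed

end
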